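(* Let $s,n\ge 1$ be integers and let $w=(x^sD^s)^n$. For each integer $k \geq 0$, $$S_w(k) = \sum_{\ell = 0}^{(s-1)(n-1)} f(n,s,\ell) {s(n-1)+1-\ell \brace k-(s-1)},$$ where $$f(n,s,\ell) = \sum_{i_1+\ldots +i_{s-1} = \ell} \binom{n-1}{i_1} \binom{2(n-1)-i_1}{i_2} \cdots \binom{(s-1)(n-1)-i_1-\ldots -i_{s-2}}{i_{s-1}},$$ the sum being over all $(s-1)$-tuples $(i_1,\ldots,i_{s-1})$ of non-negative integers with sum $\ell$.
   Context: View $x$ as the operator of multiplication by the variable $x$ and $D$ as differentiation with respect to $x$, acting on infinitely differentiable functions; a word in $\{x,D\}$ is read as the composition of these operators (so $Dx=xD+1$). For a word $w$ with equally many $x$'s and $D$'s, $(S_w(k))_{k\ge0}$ is the unique sequence of integers (finitely many nonzero) with $w=\sum_{k\ge0}S_w(k)x^kD^k$. For integers $N\ge 0$ and $j$, ${N\brace j}$ is the ordinary Stirling number of the second kind (the number of partitions of an $N$-element set into $j$ non-empty classes), which is $0$ if $j<0$. The binomial coefficient $\binom{a}{b}$ is $0$ unless $0\le b\le a$. When $s=1$ the sum defining $f$ is over the empty tuple, so $f(n,1,0)=1$. *)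

theory Defs
  imports "HOL-Analysis.Analysis" "HOL-Combinatorics.Stirling"
begin

definition smooth :: "(real \<Rightarrow> real) \<Rightarrow> bool" where
  "smooth g \<longleftrightarrow> (\<forall>m t. (deriv ^^ m) g differentiable (at t))"

datatype letter = X | D

fun letter_op :: "letter \<Rightarrow> (real \<Rightarrow> real) \<Rightarrow> real \<Rightarrow> real" where
  "letter_op X g = (\<lambda>t. t * g t)"
| "letter_op D g = deriv g"

(* The head of the list is the leftmost letter, hence the operator applied last. *)
fun word_op :: "letter list \<Rightarrow> (real \<Rightarrow> real) \<Rightarrow> real \<Rightarrow> real" where
  "word_op [] g = g"
| "word_op (a # w) g = letter_op a (word_op w g)"

(* w = sum over k of c k * x^k D^k, as operators on smooth functions. *)
definition normal_form_coeffs :: "letter list \<Rightarrow> (nat \<Rightarrow> int) \<Rightarrow> bool" where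
  "normal_form_coeffs w c \<longleftrightarrow>
     finite {k. c k \<noteq> 0} \<and>
     (\<forall>g. smooth g \<longrightarrow>
        word_op w g =
          (\<lambda>t. \<Sum>k | c k \<noteq> 0. of_int (c k) * word_op (replicate k X @ replicate k D) g t))"

(* Meaningful only for words with equally many X's and D's. *)
definition S :: "letter list \<Rightarrow> nat \<Rightarrow> int" where
  "S w = (THE c. normal_form_coeffs w c)"

definition xsDs_power :: "nat \<Rightarrow> nat \<Rightarrow> letter list" where
  "xsDs_power s n = concat (replicate n (replicate s X @ replicate s D))"

(* Binomial coefficient and Stirling number of the second kind with integer arguments,
   so that the vanishing conventions are explicit rather than a result of truncated
   subtraction on nat. *)
definition binom :: "int \<Rightarrow> int \<Rightarrow> nat" where
  "binom a b = (if 0 \<le> b \<and> b \<le> a then nat a choose nat b else 0)"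

definition stirling2 :: "nat \<Rightarrow> int \<Rightarrow> nat" where
  "stirling2 N j = (if j < 0 then 0 else Stirling N (nat j))"

(* The tuple (i_1, ..., i_{s-1}) is the list i with i ! j standing for i_{j+1}. *)
definition f :: "nat \<Rightarrow> nat \<Rightarrow> nat \<Rightarrow> nat" where
  "f n s l =
     (\<Sum>i | length i = s - 1 \<and> sum_list i = l.
        \<Prod>j<s - 1. binom ((int j + 1) * (int n - 1) - (\<Sum>t<j. int (i ! t))) (int (i ! j)))"

end

theory Submission
  imports Defs "HOL-Computational_Algebra.Polynomial"
begin

text \<open>
  Put \<open>\<theta> = xD\<close>. Since \<open>(\<theta> - k) x\<^sup>k D\<^sup>k = x\<^sup>k\<^sup>+\<^sup>1 D\<^sup>k\<^sup>+\<^sup>1\<close>, the operator \<open>x\<^sup>k D\<^sup>k\<close> is the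
  falling factorial \<open>\<theta> (\<theta> - 1) \<cdots> (\<theta> - k + 1)\<close> of \<open>\<theta>\<close>, so every word \<open>(x\<^sup>s D\<^sup>s)\<^sup>n\<close> is a polynomial
  in \<open>\<theta>\<close> and its normal ordering is the expansion of the polynomial \<open>(x)\<^sub>s\<^sup>n\<close> in the basis of falling
  factorials \<open>(x)\<^sub>k\<close>. Two facts make this precise: substituting \<open>\<theta>\<close> is multiplicative
  (\<open>euler_poly_mult\<close>), which gives existence of the normal form, and \<open>\<theta>\<close> acts on \<open>t\<^sup>m\<close> as the
  scalar \<open>m\<close>, so that monomials separate normal forms (\<open>normal_form_coeffs_unique\<close>).

  The polynomial identity behind the formula is obtained by putting \<open>y = x - (s - 1)\<close> and \<open>M = n - 1\<close>.
  Then \<open>(x)\<^sub>s = (x)\<^sub>s\<^sub>-\<^sub>1 y\<close>, and also \<open>(x)\<^sub>s\<close> is the rising factorial \<open>y (y + 1) \<cdots> (y + s - 1)\<close>, hence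
  \<open>(x)\<^sub>s\<^sup>n = (x)\<^sub>s\<^sub>-\<^sub>1 y (y (y + 1) \<cdots> (y + s - 1))\<^sup>M\<close>.
  The numbers \<open>f(n, s, l)\<close> are the coefficients of the last factor (\<open>pochhammer_power_expand\<close>): the
  power of the rising factorial arises from \<open>1\<close> by alternately multiplying by \<open>y\<^sup>M\<close> and replacing
  \<open>y\<close> by \<open>y + 1\<close>, and \<open>i\<^sub>1, \<dots>, i\<^sub>s\<^sub>-\<^sub>1\<close> record the choices made in the successive binomial expansions. What
  remains are the products \<open>(x)\<^sub>s\<^sub>-\<^sub>1 y\<^sup>N\<close>; expanding \<open>y\<^sup>N\<close> in falling factorials of \<open>y\<close> by
  Stirling numbers and using \<open>(x)\<^sub>s\<^sub>-\<^sub>1 (y)\<^sub>j = (x)\<^sub>s\<^sub>-\<^sub>1\<^sub>+\<^sub>j\<close> finishes the computation.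
\<close>

section \<open>Falling factorials\<close>

definition ffact :: "'a::comm_ring_1 \<Rightarrow> nat \<Rightarrow> 'a" where
  "ffact x k = (\<Prod>i<k. x - of_nat i)"

lemma ffact_0 [simp]: "ffact x 0 = 1"
  by (simp add: ffact_def)

lemma ffact_Suc: "ffact x (Suc k) = ffact x k * (x - of_nat k)"
  by (simp add: ffact_def)

lemma ffact_add: "ffact x (r + j) = ffact x r * ffact (x - of_nat r) j"
  by (induction j) (simp_all add: ffact_Suc algebra_simps)

text \<open>Reading the factors \<open>x, x - 1, \<dots>, x - r\<close> backwards.\<close>

lemma ffact_eq_pochhammer: "ffact x (Suc r) = pochhammer (x - of_nat r) (Suc r)"
proof -
  have "ffact x (Suc r) = (\<Prod>i<Suc r. x - of_nat (Suc r - Suc i))"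
    unfolding ffact_def by (rule prod.nat_diff_reindex [symmetric])
  also have "\<dots> = (\<Prod>i<Suc r. x - of_nat r + of_nat i)"
    by (intro prod.cong) (auto simp: of_nat_diff)
  finally show ?thesis
    by (simp add: pochhammer_prod atLeast0LessThan)
qed

lemma ffact_of_nat_eq_0:
  assumes "m < k"
  shows "ffact (of_nat m :: real) k = 0"
  using assms by (auto simp: ffact_def)

lemma ffact_of_nat_self_neq_0: "ffact (of_nat m :: real) m \<noteq> 0"
  by (auto simp: ffact_def)

text \<open>The recurrence for Stirling numbers mirrors \<open>y (y)\<^sub>j = (y)\<^sub>j\<^sub>+\<^sub>1 + j (y)\<^sub>j\<close>.\<close>

lemma power_eq_sum_Stirling_ffact:
  "y ^ N = (\<Sum>j\<le>N. of_nat (Stirling N j) * ffact y j)"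
proof (induction N)
  case 0
  then show ?case by simp
next
  case (Suc N)
  let ?a = "\<lambda>j. of_nat (Stirling N j) :: 'a"
  have "(\<Sum>j\<le>Suc N. of_nat (Stirling (Suc N) j) * ffact y j)
      = (\<Sum>j\<le>N. (?a j + of_nat (Suc j) * ?a (Suc j)) * ffact y (Suc j))"
    by (simp add: sum.atMost_Suc_shift algebra_simps del: sum.atMost_Suc)
  also have "\<dots> = (\<Sum>j\<le>N. ?a j * ffact y (Suc j))
      + (\<Sum>j\<le>N. of_nat (Suc j) * ?a (Suc j) * ffact y (Suc j))"
    by (simp only: distrib_right sum.distrib)
  also have "(\<Sum>j\<le>N. of_nat (Suc j) * ?a (Suc j) * ffact y (Suc j))
      = (\<Sum>j\<le>Suc N. of_nat j * ?a j * ffact y j)"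
    by (simp add: sum.atMost_Suc_shift del: sum.atMost_Suc)
  also have "\<dots> = (\<Sum>j\<le>N. of_nat j * ?a j * ffact y j)"
    by simp
  also have "(\<Sum>j\<le>N. ?a j * ffact y (Suc j)) + (\<Sum>j\<le>N. of_nat j * ?a j * ffact y j)
      = (\<Sum>j\<le>N. y * (?a j * ffact y j))"
    unfolding sum.distrib [symmetric]
    by (intro sum.cong) (auto simp: ffact_Suc algebra_simps)
  also have "\<dots> = y ^ Suc N"
    by (simp add: sum_distrib_left [symmetric] Suc.IH [symmetric])
  finally show ?case by simp
qed

text \<open>The factor \<open>(x)\<^sub>r\<close> turns falling factorials of \<open>x - r\<close> into falling factorials of \<open>x\<close>, which
  shifts the lower index of the Stirling numbers by \<open>r\<close>. The terms with \<open>k < r\<close> or \<open>k > r + N\<close>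
  vanish, so any upper limit \<open>K \<ge> r + N\<close> gives the same sum.\<close>

lemma ffact_mult_shifted_power:
  assumes "r + N \<le> K"
  shows "ffact x r * (x - of_nat r) ^ N
    = (\<Sum>k\<le>K. of_nat (stirling2 N (int k - int r)) * ffact x k)"
proof -
  have "(\<Sum>k\<le>K. of_nat (stirling2 N (int k - int r)) * ffact x k)
      = (\<Sum>k\<in>(+) r ` {..N}. of_nat (stirling2 N (int k - int r)) * ffact x k)"
  proof (rule sum.mono_neutral_right)
    show "\<forall>k\<in>{..K} - (+) r ` {..N}. of_nat (stirling2 N (int k - int r)) * ffact x k = 0"
    proof
      fix k assume "k \<in> {..K} - (+) r ` {..N}"
      then have "k < r \<or> r + N < k"
        by (auto simp: image_iff not_less) (metis add.commute atMost_iff le_Suc_ex nat_add_left_cancel_le not_less)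
      then show "of_nat (stirling2 N (int k - int r)) * ffact x k = 0"
        by (auto simp: stirling2_def nat_diff_distrib)
    qed
  qed (use assms in auto)
  also have "\<dots> = (\<Sum>j\<le>N. of_nat (Stirling N j) * ffact x (r + j))"
    by (subst sum.reindex) (auto simp: stirling2_def)
  also have "\<dots> = ffact x r * (\<Sum>j\<le>N. of_nat (Stirling N j) * ffact (x - of_nat r) j)"
    by (simp add: ffact_add sum_distrib_left mult_ac)
  finally show ?thesis
    by (simp add: power_eq_sum_Stirling_ffact [of "x - of_nat r" N])
qed

section \<open>The coefficients of powers of a rising factorial\<close>

lemma finite_lists_sum_list: "finite {i :: nat list. length i = r \<and> sum_list i = l}"
proof (rule finite_subset)
  show "{i. length i = r \<and> sum_list i = l} \<subseteq> {i. set i \<subseteq> {..l} \<and> length i = r}"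
    using member_le_sum_list by fastforce
qed (simp add: finite_lists_length_eq)

text \<open>Splitting off the last entry \<open>a\<close> of a tuple: the upper argument of its binomial coefficient
  depends only on the sum \<open>l - a\<close> of the other entries.\<close>

lemma f_Suc:
  "f (Suc M) (Suc (Suc r)) l
    = (\<Sum>a\<le>l. f (Suc M) (Suc r) (l - a) * binom (int (Suc r * M) - int (l - a)) (int a))"
proof -
  define A where "A = (\<lambda>r l. {i :: nat list. length i = r \<and> sum_list i = l})"
  define h where "h = (\<lambda>i j. binom ((int j + 1) * int M - (\<Sum>t<j. int (i ! t))) (int (i ! j)))"
  have f_eq: "f (Suc M) (Suc q) m = (\<Sum>i\<in>A q m. \<Prod>j<q. h i j)" for q m
    by (simp add: f_def A_def h_def)
  have fin: "finite (A q m)" for q m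
    unfolding A_def by (rule finite_lists_sum_list)
  have h_front: "h (i @ [a]) j = h i j" if "j < length i" for i a j
  proof -
    have "(\<Sum>t<j. int ((i @ [a]) ! t)) = (\<Sum>t<j. int (i ! t))"
      using that by (intro sum.cong) (auto simp: nth_append)
    then show ?thesis
      using that by (simp add: h_def nth_append)
  qed
  have h_last: "h (i @ [a]) r = binom (int (Suc r * M) - int (l - a)) (int a)"
    if "i \<in> A r (l - a)" for i a
  proof -
    have len: "length i = r" and sm: "sum_list i = l - a"
      using that by (auto simp: A_def)
    have "(\<Sum>t<r. int ((i @ [a]) ! t)) = (\<Sum>t<r. int (i ! t))"
      using len by (intro sum.cong) (auto simp: nth_append)
    also have "\<dots> = int (sum_list i)"
      using len by (simp add: sum_list_sum_nth atLeast0LessThan)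
    finally show ?thesis
      using len sm by (simp add: h_def nth_append algebra_simps)
  qed
  have "(\<Sum>a\<le>l. f (Suc M) (Suc r) (l - a) * binom (int (Suc r * M) - int (l - a)) (int a))
      = (\<Sum>a\<le>l. \<Sum>i\<in>A r (l - a). \<Prod>j<Suc r. h (i @ [a]) j)"
    unfolding f_eq sum_distrib_right
  proof (intro sum.cong refl)
    fix a i assume i: "i \<in> A r (l - a)"
    then have "length i = r" by (simp add: A_def)
    then show "(\<Prod>j<r. h i j) * binom (int (Suc r * M) - int (l - a)) (int a)
        = (\<Prod>j<Suc r. h (i @ [a]) j)"
      using h_front [of _ i a] h_last [OF i] by (simp add: mult.commute)
  qed
  also have "\<dots> = (\<Sum>(a, i)\<in>Sigma {..l} (\<lambda>a. A r (l - a)). \<Prod>j<Suc r. h (i @ [a]) j)"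
    by (rule sum.Sigma) (auto simp: fin)
  also have "\<dots> = (\<Sum>i\<in>A (Suc r) l. \<Prod>j<Suc r. h i j)"
  proof (rule sum.reindex_bij_witness [where i = "\<lambda>i. (last i, butlast i)" and j = "\<lambda>(a, i). i @ [a]"])
    fix i assume i: "i \<in> A (Suc r) l"
    then have "i \<noteq> []" and len: "length i = Suc r" and sm: "sum_list i = l"
      by (auto simp: A_def)
    then have split: "butlast i @ [last i] = i" by simp
    then have "sum_list (butlast i) + last i = l"
      using sm by (metis sum_list.Cons sum_list.Nil sum_list_append add_0_right)
    then show "(last i, butlast i) \<in> Sigma {..l} (\<lambda>a. A r (l - a))"
      using len by (auto simp: A_def)
    show "(case (last i, butlast i) of (a, i) \<Rightarrow> i @ [a]) = i"
      using split by simp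
  qed (auto simp: A_def)
  finally show ?thesis
    by (simp add: f_eq)
qed

text \<open>If \<open>l\<close> exceeds \<open>r M\<close>, then in each term of the recurrence the last entry exceeds the upper
  argument of its binomial coefficient. This lets sums over \<open>l\<close> be extended past \<open>r M\<close> freely.\<close>

lemma f_eq_0:
  assumes "r * M < l"
  shows "f (Suc M) (Suc r) l = 0"
proof (cases r)
  case 0
  then show ?thesis
    using assms by (auto simp: f_def intro!: sum.neutral)
next
  case (Suc q)
  show ?thesis
    unfolding Suc f_Suc
  proof (intro sum.neutral ballI)
    fix a assume "a \<in> {..l}"
    then have "int K - int (l - a) < int a" if "K < l" for K
      using that by auto
    from this [OF assms [unfolded Suc]]
    show "f (Suc M) (Suc q) (l - a) * binom (int (Suc q * M) - int (l - a)) (int a) = 0"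
      by (simp add: binom_def)
  qed
qed

text \<open>Passing from \<open>r\<close> to \<open>r + 1\<close> uses \<open>pochhammer y (r + 2) = y * pochhammer (y + 1) (r + 1)\<close>; each
  power of \<open>y + 1\<close> is expanded by the binomial theorem, and \<open>f_Suc\<close> collects the result by powers of \<open>y\<close>.\<close>

lemma pochhammer_power_expand:
  "pochhammer y (Suc r) ^ M
    = (\<Sum>l\<le>r * M. of_nat (f (Suc M) (Suc r) l) * y ^ (Suc r * M - l))"
proof (induction r arbitrary: y)
  case 0
  have "{i :: nat list. length i = 0 \<and> sum_list i = 0} = {[]}"
    by auto
  then have "f (Suc M) (Suc 0) 0 = 1"
    by (simp add: f_def del: length_0_conv)
  then show ?case by simp
next
  case (Suc r)
  let ?R = "Suc r * M"
  let ?F = "\<lambda>l. of_nat (f (Suc M) (Suc r) l) :: 'a"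
  let ?g = "\<lambda>l a. ?F l * of_nat (?R - l choose a) * y ^ (M + ?R - (l + a))"
  have expand: "y ^ M * (?F l * (y + 1) ^ (?R - l)) = (\<Sum>a\<le>?R - l. ?g l a)" if "l \<le> ?R" for l
  proof -
    have "(y + 1) ^ (?R - l) = (\<Sum>a\<le>?R - l. of_nat (?R - l choose a) * y ^ (?R - l - a))"
      using binomial_ring [of 1 y "?R - l"] by (simp add: add.commute)
    then have "y ^ M * (?F l * (y + 1) ^ (?R - l))
        = (\<Sum>a\<le>?R - l. ?F l * of_nat (?R - l choose a) * (y ^ M * y ^ (?R - l - a)))"
      by (simp only: sum_distrib_left mult_ac)
    also have "\<dots> = (\<Sum>a\<le>?R - l. ?g l a)"
    proof (intro sum.cong refl arg_cong2 [where f = "(*)"])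
      fix a assume "a \<in> {..?R - l}"
      then have "M + (?R - l - a) = M + ?R - (l + a)"
        using that by (simp del: mult_Suc)
      then show "y ^ M * y ^ (?R - l - a) = y ^ (M + ?R - (l + a))"
        by (simp only: power_add [symmetric])
    qed
    finally show ?thesis .
  qed
  have "pochhammer y (Suc (Suc r)) ^ M = y ^ M * pochhammer (y + 1) (Suc r) ^ M"
    by (simp add: pochhammer_rec [of y "Suc r"] power_mult_distrib)
  also have "\<dots> = (\<Sum>l\<le>r * M. y ^ M * (?F l * (y + 1) ^ (?R - l)))"
    by (simp add: Suc.IH sum_distrib_left)
  also have "\<dots> = (\<Sum>l\<le>?R. y ^ M * (?F l * (y + 1) ^ (?R - l)))"
    by (rule sum.mono_neutral_left) (auto simp: f_eq_0)
  also have "\<dots> = (\<Sum>l\<le>?R. \<Sum>a\<le>?R - l. ?g l a)"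
    by (intro sum.cong refl expand) simp
  also have "\<dots> = (\<Sum>(l, a)\<in>{(l, a). l + a \<le> ?R}. ?g l a)"
  proof -
    have "Sigma {..?R} (\<lambda>l. {..?R - l}) = {(l, a). l + a \<le> ?R}"
      by (auto simp del: mult_Suc)
    then show ?thesis
      by (simp add: sum.Sigma del: mult_Suc)
  qed
  also have "\<dots> = (\<Sum>k\<le>?R. \<Sum>l\<le>k. ?g l (k - l))"
    by (rule sum.triangle_reindex_eq)
  also have "\<dots> = (\<Sum>k\<le>?R. of_nat (f (Suc M) (Suc (Suc r)) k) * y ^ (Suc (Suc r) * M - k))"
  proof (intro sum.cong refl)
    fix k assume k: "k \<in> {..?R}"
    have "(\<Sum>l\<le>k. ?g l (k - l)) = (\<Sum>a\<le>k. ?g (k - a) a)"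
      by (rule sum.reindex_bij_witness [where i = "\<lambda>a. k - a" and j = "\<lambda>l. k - l"]) auto
    also have "\<dots> = (\<Sum>a\<le>k. of_nat (f (Suc M) (Suc r) (k - a)
        * binom (int ?R - int (k - a)) (int a)) * y ^ (Suc (Suc r) * M - k))"
    proof (intro sum.cong refl)
      fix a assume "a \<in> {..k}"
      then have "int ?R - int (k - a) = int (?R - (k - a))" "a \<le> ?R - (k - a)"
        using k by (simp_all del: mult_Suc of_nat_mult)
      then have "binom (int ?R - int (k - a)) (int a) = (?R - (k - a) choose a)"
        by (simp only: binom_def) simp
      then show "?g (k - a) a = of_nat (f (Suc M) (Suc r) (k - a)
          * binom (int ?R - int (k - a)) (int a)) * y ^ (Suc (Suc r) * M - k)"
        using \<open>a \<in> {..k}\<close> by simp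
    qed
    finally show "(\<Sum>l\<le>k. ?g l (k - l))
        = of_nat (f (Suc M) (Suc (Suc r)) k) * y ^ (Suc (Suc r) * M - k)"
      by (simp add: f_Suc sum_distrib_right)
  qed
  finally show ?case .
qed

text \<open>The two expansions combined: one factor \<open>(x)\<^sub>r\<^sub>+\<^sub>1 = (x)\<^sub>r (x - r)\<close> is kept in this form and the
  other \<open>M\<close> are written as rising factorials of \<open>x - r\<close>.\<close>

lemma ffact_power_expand:
  "ffact x (Suc r) ^ Suc M
    = (\<Sum>k\<le>Suc r * Suc M. (\<Sum>l\<le>r * M. of_nat (f (Suc M) (Suc r) l)
        * of_nat (stirling2 (Suc r * M + 1 - l) (int k - int r))) * ffact x k)"
proof -
  let ?y = "x - of_nat r" and ?K = "Suc r * Suc M"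
  let ?F = "\<lambda>l. of_nat (f (Suc M) (Suc r) l) :: 'a"
  have "ffact x (Suc r) ^ Suc M = ffact x r * ?y * pochhammer ?y (Suc r) ^ M"
    by (simp add: ffact_Suc flip: ffact_eq_pochhammer)
  also have "\<dots> = (\<Sum>l\<le>r * M. ?F l * (ffact x r * ?y ^ (Suc r * M + 1 - l)))"
    unfolding pochhammer_power_expand sum_distrib_left
  proof (intro sum.cong refl)
    fix l assume "l \<in> {..r * M}"
    then have "Suc r * M + 1 - l = Suc (Suc r * M - l)"
      by (simp add: Suc_diff_le)
    then show "ffact x r * ?y * (?F l * ?y ^ (Suc r * M - l))
        = ?F l * (ffact x r * ?y ^ (Suc r * M + 1 - l))"
      by (simp only: power_Suc mult_ac)
  qed
  also have "\<dots> = (\<Sum>l\<le>r * M. ?F l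
      * (\<Sum>k\<le>?K. of_nat (stirling2 (Suc r * M + 1 - l) (int k - int r)) * ffact x k))"
    by (intro sum.cong refl arg_cong2 [where f = "(*)"] ffact_mult_shifted_power) simp
  also have "\<dots> = (\<Sum>k\<le>?K. (\<Sum>l\<le>r * M. ?F l
      * of_nat (stirling2 (Suc r * M + 1 - l) (int k - int r))) * ffact x k)"
    unfolding sum_distrib_left sum_distrib_right
    by (subst sum.swap) (simp only: mult_ac)
  finally show ?thesis .
qed

section \<open>Smooth functions\<close>

text \<open>Closure properties are proved by exhibiting a class of functions that is stable under
  differentiation, which avoids formulas for higher derivatives.\<close>

lemma smooth_coinduct:
  assumes "P g"
    and "\<And>h. P h \<Longrightarrow> (\<forall>t. h differentiable (at t)) \<and> P (deriv h)"
  shows "smooth g"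
proof -
  have "P ((deriv ^^ m) g)" for m
    using assms by (induction m) auto
  then show ?thesis
    using assms(2) by (auto simp: smooth_def)
qed

lemma smooth_deriv:
  assumes "smooth g"
  shows "smooth (deriv g)"
  using assms unfolding smooth_def by (metis comp_apply funpow_Suc_right)

lemma smooth_DERIV:
  assumes "smooth g"
  shows "(g has_field_derivative deriv g t) (at t)"
  using assms unfolding smooth_def
  by (metis DERIV_deriv_iff_real_differentiable funpow_0)

lemma smooth_const: "smooth (\<lambda>t. c)"
  by (rule smooth_coinduct [where P = "\<lambda>h. \<exists>c. h = (\<lambda>t. c)"]) auto

lemma smooth_add:
  assumes "smooth g" "smooth h"
  shows "smooth (\<lambda>t. g t + h t)"
proof (rule smooth_coinduct [where P = "\<lambda>p. \<exists>g h. smooth g \<and> smooth h \<and> p = (\<lambda>t. g t + h t)"])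
  fix p assume "\<exists>g h. smooth g \<and> smooth h \<and> p = (\<lambda>t. g t + h t)"
  then obtain g h where gh: "smooth g" "smooth h" and p: "p = (\<lambda>t. g t + h t)"
    by blast
  have der: "(p has_field_derivative deriv g t + deriv h t) (at t)" for t
    unfolding p by (intro DERIV_add smooth_DERIV gh)
  then have "deriv p = (\<lambda>t. deriv g t + deriv h t)"
    by (auto intro: DERIV_imp_deriv)
  with der gh show "(\<forall>t. p differentiable (at t)) \<and>
      (\<exists>g h. smooth g \<and> smooth h \<and> deriv p = (\<lambda>t. g t + h t))"
    by (meson real_differentiable_def smooth_deriv)
qed (use assms in blast)

text \<open>Differentiating \<open>t g(t)\<close> produces \<open>t g'(t) + g(t)\<close>, so the stable class must allow an
  additional smooth summand.\<close>

lemma smooth_mult_ident: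
  assumes "smooth g"
  shows "smooth (\<lambda>t. t * g t)"
proof (rule smooth_coinduct [where P = "\<lambda>p. \<exists>g h. smooth g \<and> smooth h \<and> p = (\<lambda>t. t * g t + h t)"])
  fix p assume "\<exists>g h. smooth g \<and> smooth h \<and> p = (\<lambda>t. t * g t + h t)"
  then obtain g h where gh: "smooth g" "smooth h" and p: "p = (\<lambda>t. t * g t + h t)"
    by blast
  have der: "(p has_field_derivative t * deriv g t + (g t + deriv h t)) (at t)" for t
    unfolding p by (auto intro!: derivative_eq_intros smooth_DERIV gh)
  then have "deriv p = (\<lambda>t. t * deriv g t + (g t + deriv h t))"
    by (auto intro: DERIV_imp_deriv)
  moreover have "\<forall>t. p differentiable (at t)"
    using der real_differentiable_def by blast
  ultimately show "(\<forall>t. p differentiable (at t)) \<and>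
      (\<exists>g h. smooth g \<and> smooth h \<and> deriv p = (\<lambda>t. t * g t + h t))"
    using gh
    by (intro conjI exI [of _ "deriv g"] exI [of _ "\<lambda>t. g t + deriv h t"])
      (simp_all add: smooth_deriv smooth_add)
next
  show "\<exists>a b. smooth a \<and> smooth b \<and> (\<lambda>t. t * g t) = (\<lambda>t. t * a t + b t)"
    using assms smooth_const [of 0] by (intro exI [of _ g] exI [of _ "\<lambda>t. 0"]) simp
qed

lemma smooth_cmult:
  assumes "smooth g"
  shows "smooth (\<lambda>t. c * g t)"
proof (rule smooth_coinduct [where P = "\<lambda>p. \<exists>g. smooth g \<and> p = (\<lambda>t. c * g t)"])
  fix p assume "\<exists>g. smooth g \<and> p = (\<lambda>t. c * g t)"
  then obtain g where g: "smooth g" and p: "p = (\<lambda>t. c * g t)"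
    by blast
  have der: "(p has_field_derivative c * deriv g t) (at t)" for t
    unfolding p by (intro DERIV_cmult smooth_DERIV g)
  then have "deriv p = (\<lambda>t. c * deriv g t)"
    by (auto intro: DERIV_imp_deriv)
  with der g show "(\<forall>t. p differentiable (at t)) \<and> (\<exists>g. smooth g \<and> deriv p = (\<lambda>t. c * g t))"
    by (meson real_differentiable_def smooth_deriv)
qed (use assms in blast)

lemma smooth_power: "smooth (\<lambda>t. t ^ m)"
  by (induction m) (simp_all add: smooth_const smooth_mult_ident)

section \<open>Polynomials in the Euler operator\<close>

text \<open>The operator \<open>p(\<theta>)\<close> with \<open>\<theta> = xD\<close>, in Horner form like \<^const>\<open>poly\<close>.\<close>

definition euler_poly :: "real poly \<Rightarrow> (real \<Rightarrow> real) \<Rightarrow> real \<Rightarrow> real" where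
  "euler_poly p g = fold_coeffs (\<lambda>a h t. a * g t + t * deriv h t) p (\<lambda>t. 0)"

lemma euler_poly_0 [simp]: "euler_poly 0 g = (\<lambda>t. 0)"
  by (simp add: euler_poly_def)

lemma euler_poly_pCons:
  "euler_poly (pCons a p) g = (\<lambda>t. a * g t + t * deriv (euler_poly p g) t)"
  by (cases "p = 0 \<and> a = 0") (auto simp: euler_poly_def)

lemma smooth_euler_poly:
  assumes "smooth g"
  shows "smooth (euler_poly p g)"
  using assms
  by (induction p)
    (simp_all add: euler_poly_pCons smooth_const smooth_add smooth_cmult smooth_mult_ident smooth_deriv)

lemma deriv_smooth_add:
  assumes "smooth g" "smooth h"
  shows "deriv (\<lambda>t. g t + h t) t = deriv g t + deriv h t"
  by (intro DERIV_imp_deriv DERIV_add smooth_DERIV assms)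

lemma deriv_smooth_cmult:
  assumes "smooth g"
  shows "deriv (\<lambda>t. c * g t) t = c * deriv g t"
  by (intro DERIV_imp_deriv DERIV_cmult smooth_DERIV assms)

lemma euler_poly_add:
  assumes "smooth g"
  shows "euler_poly (p + q) g = (\<lambda>t. euler_poly p g t + euler_poly q g t)"
  by (induction p q rule: poly_induct2)
    (simp_all add: euler_poly_pCons deriv_smooth_add smooth_euler_poly assms algebra_simps)

lemma euler_poly_smult:
  assumes "smooth g"
  shows "euler_poly (smult c p) g = (\<lambda>t. c * euler_poly p g t)"
  by (induction p)
    (simp_all add: euler_poly_pCons deriv_smooth_cmult smooth_euler_poly assms algebra_simps)

lemma euler_poly_sum:
  assumes "smooth g"
  shows "euler_poly (\<Sum>k\<in>A. p k) g t = (\<Sum>k\<in>A. euler_poly (p k) g t)"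
  by (induction A rule: infinite_finite_induct) (simp_all add: euler_poly_add assms)

lemma euler_poly_mult:
  assumes "smooth g"
  shows "euler_poly (p * q) g = euler_poly p (euler_poly q g)"
  by (induction p) (simp_all add: euler_poly_add euler_poly_smult euler_poly_pCons assms)

lemma euler_poly_1 [simp]: "euler_poly 1 g = g"
  by (simp add: one_pCons euler_poly_pCons)

text \<open>Monomials are the eigenfunctions of \<open>\<theta>\<close>.\<close>

lemma euler_poly_monomial: "euler_poly p (\<lambda>t. t ^ m) = (\<lambda>t. poly p (of_nat m) * t ^ m)"
proof (induction p)
  case (pCons a p)
  have "deriv (\<lambda>t. poly p (real m) * t ^ m) t = poly p (real m) * (real m * t ^ (m - 1))" for t
    by (rule DERIV_imp_deriv) (auto intro!: derivative_eq_intros)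
  then have e: "t * deriv (\<lambda>t. poly p (real m) * t ^ m) t = real m * poly p (real m) * t ^ m" for t
    by (cases m) simp_all
  show ?case
    unfolding euler_poly_pCons pCons.IH e by (simp add: algebra_simps)
qed simp

lemma smooth_funpow_deriv: "smooth g \<Longrightarrow> smooth ((deriv ^^ k) g)"
  by (induction k) (simp_all add: smooth_deriv)

text \<open>The induction step is the operator identity \<open>(\<theta> - k) x\<^sup>k D\<^sup>k = x\<^sup>k\<^sup>+\<^sup>1 D\<^sup>k\<^sup>+\<^sup>1\<close>.\<close>

lemma euler_poly_ffact:
  assumes "smooth g"
  shows "euler_poly (ffact [:0, 1:] k) g = (\<lambda>t. t ^ k * (deriv ^^ k) g t)"
proof (induction k)
  case (Suc k)
  let ?h = "(deriv ^^ k) g"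
  have lin: "[:0, 1:] - of_nat k = [:- real k, 1:]"
    by (simp add: of_nat_poly)
  have der: "deriv (\<lambda>t. t ^ k * ?h t) t = real k * t ^ (k - 1) * ?h t + t ^ k * deriv ?h t" for t
    by (rule DERIV_imp_deriv)
      (auto intro!: derivative_eq_intros smooth_DERIV smooth_funpow_deriv assms)
  have pow: "t * t ^ (k - 1) * real k = real k * t ^ k" for t :: real
    by (cases k) auto
  have "euler_poly (ffact [:0, 1:] (Suc k)) g
      = euler_poly [:- real k, 1:] (\<lambda>t. t ^ k * ?h t)"
    unfolding ffact_Suc lin Suc.IH [symmetric]
    by (subst mult.commute) (rule euler_poly_mult [OF assms])
  also have "\<dots> = (\<lambda>t. t ^ Suc k * deriv ?h t)"
  proof
    fix t
    show "euler_poly [:- real k, 1:] (\<lambda>t. t ^ k * ?h t) t = t ^ Suc k * deriv ?h t"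
      using arg_cong [OF pow [of t], of "\<lambda>u. u * ?h t"]
      by (simp add: euler_poly_pCons der distrib_left mult_ac)
  qed
  finally show ?case by simp
qed simp

section \<open>Words as polynomials in the Euler operator\<close>

lemma word_op_append: "word_op (u @ v) g = word_op u (word_op v g)"
  by (induction u) simp_all

lemma word_op_replicate_D: "word_op (replicate k D) g = (deriv ^^ k) g"
  by (induction k) simp_all

lemma word_op_replicate_X: "word_op (replicate k X) g = (\<lambda>t. t ^ k * g t)"
  by (induction k) (simp_all add: mult_ac)

lemma word_op_block:
  assumes "smooth g"
  shows "word_op (replicate k X @ replicate k D) g = euler_poly (ffact [:0, 1:] k) g"
  by (simp add: word_op_append word_op_replicate_D word_op_replicate_X euler_poly_ffact assms)

lemma word_op_xsDs_power:
  assumes "smooth g"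
  shows "word_op (xsDs_power s n) g = euler_poly (ffact [:0, 1:] s ^ n) g"
proof (induction n)
  case 0
  then show ?case by (simp add: xsDs_power_def)
next
  case (Suc n)
  have "xsDs_power s (Suc n) = (replicate s X @ replicate s D) @ xsDs_power s n"
    by (simp add: xsDs_power_def)
  then show ?case
    by (simp only: word_op_append [of "_ @ _"] Suc.IH word_op_block smooth_euler_poly assms
        power_Suc euler_poly_mult)
qed

text \<open>Evaluating both sides on \<open>t\<^sup>m\<close> at \<open>t = 1\<close> gives a triangular linear system in the
  coefficients, as \<open>(m)\<^sub>k\<close> vanishes for \<open>k > m\<close> but not for \<open>k = m\<close>.\<close>

lemma normal_form_coeffs_unique:
  assumes "normal_form_coeffs w c" "normal_form_coeffs w d"
  shows "c = d"
proof -
  have eval: "word_op w (\<lambda>t. t ^ m) 1 = (\<Sum>k\<le>m. of_int (c k) * ffact (of_nat m) k)"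
    if nf: "normal_form_coeffs w c" for c m
  proof -
    have poly_ffact: "poly (ffact [:0, 1:] k) (of_nat m) = ffact (of_nat m :: real) k" for k
      by (simp add: ffact_def poly_prod of_nat_poly)
    have "word_op w (\<lambda>t. t ^ m) 1
        = (\<Sum>k | c k \<noteq> 0. of_int (c k) * ffact (of_nat m) k)"
      using nf unfolding normal_form_coeffs_def
      by (simp add: smooth_power word_op_block euler_poly_monomial poly_ffact)
    also have "\<dots> = (\<Sum>k\<in>{k. c k \<noteq> 0} \<union> {..m}. of_int (c k) * ffact (of_nat m) k)"
      using nf by (intro sum.mono_neutral_left) (auto simp: normal_form_coeffs_def)
    also have "\<dots> = (\<Sum>k\<le>m. of_int (c k) * ffact (of_nat m) k)"
      using nf by (intro sum.mono_neutral_right) (auto simp: normal_form_coeffs_def ffact_of_nat_eq_0)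
    finally show ?thesis .
  qed
  have "c m = d m" for m
  proof (induction m rule: less_induct)
    case (less m)
    have "(\<Sum>k<m. of_int (c k) * ffact (of_nat m) k) + of_int (c m) * ffact (of_nat m :: real) m
        = (\<Sum>k<m. of_int (d k) * ffact (of_nat m) k) + of_int (d m) * ffact (of_nat m) m"
      using eval [OF assms(1), of m] eval [OF assms(2), of m]
      by (simp flip: lessThan_Suc_atMost)
    then have "real_of_int (c m) * ffact (of_nat m) m = real_of_int (d m) * ffact (of_nat m) m"
      using less by simp
    then show ?case
      using ffact_of_nat_self_neq_0 [of m] by simp
  qed
  then show ?thesis by blast
qed

theorem theorem2p10:
  fixes s n k :: nat
  assumes "s \<ge> 1" and "n \<ge> 1"
  shows "S (xsDs_power s n) k =
    (\<Sum>l = 0..(s - 1) * (n - 1).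
       int (f n s l) * int (stirling2 (s * (n - 1) + 1 - l) (int k - (int s - 1))))"
proof -
  obtain r M where s: "s = Suc r" and n: "n = Suc M"
    using assms by (metis One_nat_def Suc_le_D)
  define c where "c = (\<lambda>k. \<Sum>l\<le>r * M. int (f n s l) * int (stirling2 (s * M + 1 - l) (int k - int r)))"
  \<comment> \<open>The degree of \<open>(x)\<^sub>s\<^sup>n\<close> bounds the support.\<close>
  have supp: "{k. c k \<noteq> 0} \<subseteq> {..s * n}"
  proof (rule subsetI, rule ccontr)
    fix k assume "k \<in> {k. c k \<noteq> 0}" "k \<notin> {..s * n}"
    then have k: "c k \<noteq> 0" "s * n < k" by simp_all
    have "stirling2 (s * M + 1 - l) (int k - int r) = 0" for l
    proof -
      have "s * M + 1 - l < nat (int k - int r)"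
        using k(2) by (simp add: s n)
      then show ?thesis by (simp add: stirling2_def)
    qed
    then show False
      using k(1) by (simp add: c_def)
  qed
  have "normal_form_coeffs (xsDs_power s n) c"
    unfolding normal_form_coeffs_def
  proof (intro conjI allI impI ext)
    show "finite {k. c k \<noteq> 0}"
      using supp finite_subset by blast
  next
    fix g t assume g: "smooth g"
    define x :: "real poly" where "x = [:0, 1:]"
    have "of_int (c k) = (\<Sum>l\<le>r * M. of_nat (f (Suc M) (Suc r) l)
        * of_nat (stirling2 (Suc r * M + 1 - l) (int k - int r)) :: real poly)" for k
      by (simp add: c_def s n)
    then have "ffact x s ^ n = (\<Sum>k\<le>s * n. of_int (c k) * ffact x k)"
      by (simp only: s n ffact_power_expand)
    then have "ffact [:0, 1:] s ^ n = (\<Sum>k\<le>s * n. smult (real_of_int (c k)) (ffact [:0, 1:] k))"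
      by (simp add: of_int_poly x_def)
    then have "word_op (xsDs_power s n) g t
        = (\<Sum>k\<le>s * n. of_int (c k) * word_op (replicate k X @ replicate k D) g t)"
      by (simp add: word_op_xsDs_power euler_poly_sum euler_poly_smult word_op_block g)
    also have "\<dots> = (\<Sum>k | c k \<noteq> 0. of_int (c k) * word_op (replicate k X @ replicate k D) g t)"
      using supp by (intro sum.mono_neutral_right) auto
    finally show "word_op (xsDs_power s n) g t
        = (\<Sum>k | c k \<noteq> 0. of_int (c k) * word_op (replicate k X @ replicate k D) g t)" .
  qed
  then have "S (xsDs_power s n) = c"
    unfolding S_def by (blast intro: the_equality normal_form_coeffs_unique)
  then show ?thesis
    by (simp add: c_def s n atMost_atLeast0)
qed

end
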